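(* Let $0=u_+<u_-$, let $s\in\mathbb{R}$, and let $f:\mathbb{R}\to\mathbb{R}$. Put $$g(u):=f(u)-f(u_\pm)-s(u-u_\pm).$$ Suppose that, for integers $k_\pm\ge 0$, $f\in C^{\max\{k_\pm+1,3\}}(\mathbb{R})$ and $$g'(u_\pm)=\cdots=g^{(k_\pm)}(u_\pm)=0,\qquad g^{(k_\pm+1)}(u_\pm)\neq 0 .$$ (i) If the equation $u_t-(\ln u)_{xx}+f(u)_x=0$ admits a shock profile $U(x-st)$ connecting $0$ and $u_-$, then $u_-$ and $s$ must satisfy the Rankine-Hugoniot condition $$s=\frac{f(0)-f(u_-)}{0-u_-}$$ and the generalized shock condition $$g(u)<0\quad\text{for all } u\in(0,u_-).$$ (ii) Conversely, suppose that the Rankine-Hugoniot condition $s=\frac{f(0)-f(u_-)}{0-u_-}$ and the generalized shock condition $g(u)<0$ for $u\in(0,u_-)$ hold. Then there exists a shock profile $U(x-st)$ of $u_t-(\ln u)_{xx}+f(u)_x=0$ connecting $0$ and $u_-$. The shock profile $U(z)$ is unique up to a shift in $z$ and satisfies $U_z(z)<0$ for all $z\in\mathbb{R}$. Moreover, with $\lambda_-=u_-(f'(u_-)-s)$: - if $f'(0)<s<f'(u_-)$, then $|U(z)-0|\sim |z|^{-1}$ as $z\to+\infty$ and $|U(z)-u_-|\sim e^{-\lambda_-|z|}$ as $z\to-\infty$; - if $f'(0)=s$, then $|U(z)-0|\sim |z|^{-\frac{1}{1+k_+}}$ as $z\to+\infty$; - if $f'(u_-)=s$, then $|U(z)-u_-|\sim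 |z|^{-\frac{1}{k_-}}$ as $z\to-\infty$.
   Context: A shock profile (with speed $s$) of $u_t-(\ln u)_{xx}+f(u)_x=0$ connecting $0$ and $u_-$ is a non-constant smooth solution of the form $u(x,t)=U(x-st)$, where with $z=x-st$ the function $U$ satisfies $$-sU_z-\Big(\frac{U_z}{U}\Big)_z+f(U)_z=0,\ z\in\mathbb{R},\qquad U(+\infty)=0,\quad U(-\infty)=u_- .$$ In the definition of $g$, the two expressions (with $u_+$ and with $u_-$) coincide when the Rankine-Hugoniot condition holds; the derivatives of $g$ of order $\ge1$ do not depend on the choice. The list of vanishing derivatives is empty at $u_+$ (resp. $u_-$) if $k_+=0$ (resp. $k_-=0$). The notation $A(z)\sim B(z)$ means that $C^{-1}B(z)\le A(z)\le C\,B(z)$ for some constant $C>0$ in the indicated range of $z$ (here, for all $z$ sufficiently close to the indicated infinity).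
   Formalization: In (i), the Rankine-Hugoniot condition (and g<0 with base point 0) is claimed only for profiles with U_z/U→0 at +∞; otherwise it fails: f=0, s=-1, u_-=1, U=1/(1+e^z). g<0 with base point u_- needs no such condition. "Smooth" means C^2. *)

theory Defs
  imports "HOL-Analysis.Analysis"
begin

definition C_k :: "nat \<Rightarrow> (real \<Rightarrow> real) \<Rightarrow> bool" where
  "C_k k h \<longleftrightarrow>
     (\<forall>i<k. \<forall>x. ((deriv ^^ i) h) differentiable (at x)) \<and> continuous_on UNIV ((deriv ^^ k) h)"

(* The function g(u) = f(u) - f(v) - s (u - v), with base point v = u_+ = 0 or v = u_-.  The two
   base points give the same function exactly under the Rankine-Hugoniot condition. *)
definition gfun :: "(real \<Rightarrow> real) \<Rightarrow> real \<Rightarrow> real \<Rightarrow> real \<Rightarrow> real" where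
  "gfun f s v u = f u - f v - s * (u - v)"

definition exact_order :: "(real \<Rightarrow> real) \<Rightarrow> real \<Rightarrow> nat \<Rightarrow> bool" where
  "exact_order h v k \<longleftrightarrow> (\<forall>i\<in>{1..k}. (deriv ^^ i) h v = 0) \<and> (deriv ^^ (k + 1)) h v \<noteq> 0"

definition rankine_hugoniot :: "(real \<Rightarrow> real) \<Rightarrow> real \<Rightarrow> real \<Rightarrow> bool" where
  "rankine_hugoniot f s um \<longleftrightarrow> s = (f 0 - f um) / (0 - um)"

(* u_t - (ln u)_xx + f(u)_x = 0; positivity is what gives ln u its meaning. *)
definition pde_solution :: "(real \<Rightarrow> real) \<Rightarrow> (real \<Rightarrow> real \<Rightarrow> real) \<Rightarrow> bool" where
  "pde_solution f u \<longleftrightarrow>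
     (\<forall>x t. u x t > 0 \<and>
        deriv (\<lambda>\<tau>. u x \<tau>) t - (deriv ^^ 2) (\<lambda>\<xi>. ln (u \<xi> t)) x + deriv (\<lambda>\<xi>. f (u \<xi> t)) x = 0)"

(* "Smooth" is the regularity C^2 of a classical solution: f has only finitely many derivatives, so
   a profile need not be of class C^infinity.  For differentiable f, all functions to which deriv is
   applied, here and in the pde, are differentiable when U is C^2 and positive. *)
definition shock_profile :: "(real \<Rightarrow> real) \<Rightarrow> real \<Rightarrow> real \<Rightarrow> (real \<Rightarrow> real) \<Rightarrow> bool" where
  "shock_profile f s um U \<longleftrightarrow>
     C_k 2 U \<and> \<not> (\<exists>c. \<forall>z. U z = c) \<and>
     pde_solution f (\<lambda>x t. U (x - s * t)) \<and>
     (\<forall>z. - s * deriv U z - deriv (\<lambda>y. deriv U y / U y) z + deriv (\<lambda>y. f (U y)) z = 0) \<and>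
     (U \<longlongrightarrow> 0) at_top \<and> (U \<longlongrightarrow> um) at_bot"

(* The diffusive flux U_z / U vanishes at the end z = +infinity where U tends to 0.  (At -infinity,
   where U tends to u_- > 0, this is automatic.)  Integrating the profile equation over the whole
   line gives the Rankine-Hugoniot condition only if the flux vanishes at both ends, and at +infinity
   this does not follow from the definition of a shock profile: see the lemma below. *)
definition vanishing_flux :: "(real \<Rightarrow> real) \<Rightarrow> bool" where
  "vanishing_flux U \<longleftrightarrow> ((\<lambda>z. deriv U z / U z) \<longlongrightarrow> 0) at_top"

(* Comparability A(z) ~ B(z) near the end F (at_top or at_bot) of the real line. *)
definition comparable :: "real filter \<Rightarrow> (real \<Rightarrow> real) \<Rightarrow> (real \<Rightarrow> real) \<Rightarrow> bool" where
  "comparable F A B \<longleftrightarrow>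
     (\<exists>C>0. eventually (\<lambda>z. inverse C * B z \<le> A z \<and> A z \<le> C * B z) F)"

(* The logistic wave: f = 0, s = -1, u_- = 1, U(z) = 1 / (1 + exp z). *)
lemma shock_profile_without_rankine_hugoniot:
  defines "f \<equiv> (\<lambda>u::real. 0::real)" and "U \<equiv> (\<lambda>z::real. 1 / (1 + exp z))"
  shows "C_k 3 f" "exact_order (gfun f (-1) 0) 0 0" "exact_order (gfun f (-1) 1) 1 0"
    "shock_profile f (-1) 1 U" "\<not> rankine_hugoniot f (-1) 1"
proof -
  have e: "1 + exp z \<noteq> (0::real)" for z
    by (smt (verit) exp_gt_zero)
  have pos: "U z > 0" for z
    unfolding U_def by (simp add: add_pos_pos)
  have DU: "(U has_real_derivative (U z)\<^sup>2 - U z) (at z)" for z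
  proof -
    have "(U has_real_derivative - exp z / (1 + exp z)\<^sup>2) (at z)"
      unfolding U_def by (rule derivative_eq_intros refl e)+ (simp add: power2_eq_square)
    moreover have "- (w - 1) / w\<^sup>2 = (1 / w)\<^sup>2 - 1 / w" if "w \<noteq> 0" for w :: real
      using that by (simp add: field_simps power2_eq_square)
    from this[OF e[of z]] have "- exp z / (1 + exp z)\<^sup>2 = (U z)\<^sup>2 - U z"
      by (simp add: U_def)
    ultimately show ?thesis by simp
  qed
  have dU: "deriv U = (\<lambda>z. (U z)\<^sup>2 - U z)"
    by (rule ext, rule DERIV_imp_deriv, rule DU)
  have DU2: "((\<lambda>z. (U z)\<^sup>2 - U z) has_real_derivative (2 * U z - 1) * ((U z)\<^sup>2 - U z)) (at z)" for z
    by (rule derivative_eq_intros DU refl)+ (simp add: algebra_simps)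
  have ddU: "deriv (deriv U) = (\<lambda>z. (2 * U z - 1) * ((U z)\<^sup>2 - U z))"
    unfolding dU by (rule ext, rule DERIV_imp_deriv, rule DU2)
  have cont: "continuous_on UNIV U"
    using DU by (meson DERIV_isCont continuous_at_imp_continuous_on)
  have C2: "C_k 2 U"
    unfolding C_k_def
  proof (intro conjI allI impI)
    fix i :: nat and x :: real assume "i < 2"
    then have "i = 0 \<or> i = 1" by auto
    then show "(deriv ^^ i) U differentiable at x"
      using DU[of x] DU2[of x] by (auto simp: dU real_differentiable_def)
  next
    show "continuous_on UNIV ((deriv ^^ 2) U)"
      by (simp add: numeral_2_eq_2 ddU) (intro continuous_intros cont)
  qed
  have flux: "(\<lambda>y. deriv U y / U y) = (\<lambda>y. U y - 1)"
    by (rule ext) (use pos in \<open>simp add: dU field_simps power2_eq_square less_imp_neq[symmetric]\<close>)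
  have dflux: "deriv (\<lambda>y. U y - 1) z = (U z)\<^sup>2 - U z" for z
    by (rule DERIV_imp_deriv) (rule derivative_eq_intros DU refl | simp)+
  have U_shift: "((\<lambda>y. U (y + c)) has_real_derivative (U (y + c))\<^sup>2 - U (y + c)) (at y)" for y c
    by (rule DERIV_chain2[where g = "\<lambda>y. y + c" and Db = 1, OF DU, simplified])
      (rule derivative_eq_intros refl | simp)+
  have ln1: "deriv (\<lambda>\<xi>. ln (U (\<xi> + t))) = (\<lambda>\<xi>. U (\<xi> + t) - 1)" for t
  proof (rule ext, rule DERIV_imp_deriv)
    fix x show "((\<lambda>\<xi>. ln (U (\<xi> + t))) has_real_derivative U (x + t) - 1) (at x)"
      by (rule derivative_eq_intros U_shift refl pos)+
        (use pos[of "x + t"] in \<open>simp add: field_simps power2_eq_square\<close>)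
  qed
  have ln2: "deriv (\<lambda>\<xi>. U (\<xi> + t) - 1) x = (U (x + t))\<^sup>2 - U (x + t)" for t x
    by (rule DERIV_imp_deriv) (rule derivative_eq_intros U_shift refl | simp)+
  have time: "deriv (\<lambda>\<tau>. U (x + \<tau>)) t = (U (x + t))\<^sup>2 - U (x + t)" for x t
    using DERIV_imp_deriv[OF U_shift[of x t]] by (simp add: add.commute)
  have pde: "pde_solution f (\<lambda>x t. U (x - (-1) * t))"
    unfolding pde_solution_def f_def by (simp add: pos numeral_2_eq_2 ln1 ln2 time)
  have top: "(U \<longlongrightarrow> 0) at_top"
    unfolding U_def
    by (rule real_tendsto_divide_at_top[OF tendsto_const])
      (rule filterlim_tendsto_add_at_top[OF tendsto_const exp_at_top])
  have bot: "(U \<longlongrightarrow> 1) at_bot"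
    unfolding U_def by (rule tendsto_eq_intros exp_at_bot refl | simp)+
  have nc: "\<not> (\<exists>c. \<forall>z. U z = c)"
  proof
    assume "\<exists>c. \<forall>z. U z = c"
    then have "U 0 = U (ln 2)" by metis
    then show False by (simp add: U_def)
  qed
  show "shock_profile f (-1) 1 U"
    unfolding shock_profile_def flux dflux
    using C2 nc pde top bot by (simp add: dU f_def)
  show "\<not> rankine_hugoniot f (-1) 1"
    by (simp add: rankine_hugoniot_def f_def)
  have z: "(deriv ^^ i) (\<lambda>u::real. 0::real) = (\<lambda>u. 0)" for i
    by (induction i) auto
  show "C_k 3 f"
    unfolding C_k_def f_def z by simp
  have dg: "deriv (gfun f (-1) v) v = 1" for v
    unfolding gfun_def f_def
    by (rule DERIV_imp_deriv) (rule derivative_eq_intros refl | simp)+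
  show "exact_order (gfun f (-1) 0) 0 0" "exact_order (gfun f (-1) 1) 1 0"
    by (simp_all add: exact_order_def dg)
qed

end

(* Integrating the profile equation from -infinity gives the scalar equation U' = U g(U), where g
   has base point u_- and the constant of integration is fixed by U(-infinity) = u_-.  An orbit never
   meets an equilibrium, so a profile runs through all of (0, u_-) and g has no zero there; as U
   decreases from u_- to 0, g < 0.  Conversely, for g < 0 the solutions are the inverses of the time
   map H with H' = 1 / (u g(u)), which gives existence and uniqueness up to a shift.  The rates follow
   from the leading Taylor coefficient of g at the end states: if W' = - R W^(m+1) and R -> c > 0,
   then W^(-m) grows linearly. *)
theory Submission
  imports Defs
begin

section \<open>Iterated derivatives\<close>

text \<open>The two end states are not symmetric. The equation controls
  \<open>U_z = U * (U_z / U)\<close>. At -infinity, where \<open>U\<close> tends to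
  \<open>u_-\<close>, which is positive, this forces the flux \<open>U_z / U\<close> to vanish. At
  +infinity the factor \<open>U\<close> tends to 0 and hides a nonzero limit of the flux. So the
  sign of \<open>g\<close> is derived with base point \<open>u_-\<close>, and the Rankine-Hugoniot
  condition has to come from \<open>vanishing_flux\<close>. The same factor \<open>U\<close>
  explains the exponents. At 0 it raises the order of the right-hand side to \<open>k_+ + 2\<close>,
  so the decay is algebraic even for \<open>k_+ = 0\<close>. At \<open>u_-\<close> it only
  contributes a constant, and \<open>k_- = 0\<close> is the linear case: there a limit of
  \<open>R\<close> fixes \<open>W\<close> only up to a subexponential factor, and comparability with
  an exponential needs a bound on the distance of \<open>R\<close> from its limit.\<close>

lemma C_k_Suc:
  "C_k (Suc n) h \<longleftrightarrow> (\<forall>x. h differentiable (at x)) \<and> C_k n (deriv h)"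
proof -
  have "(\<forall>i<Suc n. P i) \<longleftrightarrow> P 0 \<and> (\<forall>i<n. P (Suc i))" for P
    by (simp add: All_less_Suc2)
  then show ?thesis
    unfolding C_k_def by (simp add: funpow_Suc_right del: funpow.simps(2))
qed

lemma C_k_mono:
  assumes "C_k n h" "m \<le> n"
  shows "C_k m h"
proof (cases "m = n")
  case False
  with assms have "m < n" by simp
  then have "\<forall>x. (deriv ^^ m) h differentiable (at x)"
    using assms unfolding C_k_def by blast
  then have "continuous_on UNIV ((deriv ^^ m) h)"
    by (simp add: continuous_on_eq_continuous_at differentiable_imp_continuous_within)
  then show ?thesis
    using assms unfolding C_k_def by auto
qed (use assms in simp)

lemma C_k_diff_const:
  assumes "C_k n h"
  shows "C_k n (\<lambda>u. h u - c)"
proof (cases n)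
  case 0
  with assms show ?thesis
    by (auto simp: C_k_def intro!: continuous_intros)
next
  case (Suc m)
  have "deriv (\<lambda>u. h u - c) = deriv h"
  proof
    fix u
    have "h differentiable (at u)"
      using assms Suc C_k_Suc by blast
    then have "(h has_real_derivative deriv h u) (at u)"
      using DERIV_deriv_iff_real_differentiable by blast
    then have "((\<lambda>u. h u - c) has_real_derivative deriv h u) (at u)"
      by (auto intro!: derivative_eq_intros)
    then show "deriv (\<lambda>u. h u - c) u = deriv h u"
      by (rule DERIV_imp_deriv)
  qed
  with assms Suc show ?thesis
    by (auto simp: C_k_Suc)
qed

lemma gfun_has_derivative:
  assumes "f differentiable (at u)"
  shows "(gfun f s v has_real_derivative deriv f u - s) (at u)"
proof -
  have "(f has_real_derivative deriv f u) (at u)"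
    using assms DERIV_deriv_iff_real_differentiable by blast
  then show ?thesis
    unfolding gfun_def by (auto intro!: derivative_eq_intros)
qed

lemma C_k_gfun:
  assumes "C_k (Suc n) f"
  shows "C_k (Suc n) (gfun f s v)"
proof -
  have d: "f differentiable (at u)" for u
    using assms C_k_Suc by blast
  have "deriv (gfun f s v) = (\<lambda>u. deriv f u - s)"
    using gfun_has_derivative[OF d] DERIV_imp_deriv by blast
  moreover have "C_k n (\<lambda>u. deriv f u - s)"
    using assms by (intro C_k_diff_const) (simp add: C_k_Suc)
  ultimately show ?thesis
    using gfun_has_derivative[OF d] real_differentiable_def
    by (auto simp: C_k_Suc)
qed

text \<open>Induction by l'Hopital: passing to \<open>deriv h\<close> uses up one zero, until only
  the difference quotient of a function vanishing at \<open>v\<close> remains. The factors produced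
  by differentiating the denominator build up the factorial.\<close>

lemma taylor_leading_term:
  assumes "C_k (Suc k) h" "\<And>i. i \<le> k \<Longrightarrow> (deriv ^^ i) h v = 0"
  shows "((\<lambda>u. h u / (u - v) ^ Suc k) \<longlongrightarrow> (deriv ^^ Suc k) h v / fact (Suc k)) (at v)"
  using assms
proof (induction k arbitrary: h)
  case 0
  then have "(h has_real_derivative deriv h v) (at v)"
    using C_k_Suc DERIV_deriv_iff_real_differentiable by blast
  moreover have "h v = 0" using 0(2)[of 0] by simp
  ultimately show ?case
    by (simp add: has_field_derivative_iff)
next
  case (Suc k)
  have D: "(h has_real_derivative deriv h u) (at u)" for u
    using Suc.prems C_k_Suc DERIV_deriv_iff_real_differentiable by blast
  have "(deriv ^^ i) (deriv h) v = 0" if "i \<le> k" for i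
    using Suc.prems(2)[of "Suc i"] that by (simp only: funpow_Suc_right o_apply Suc_le_mono)
  then have "((\<lambda>u. deriv h u / (u - v) ^ Suc k) \<longlongrightarrow>
      (deriv ^^ Suc k) (deriv h) v / fact (Suc k)) (at v)"
    using Suc.prems(1) by (intro Suc.IH) (simp_all add: C_k_Suc)
  then have "((\<lambda>u. deriv h u / (u - v) ^ Suc k / real (Suc (Suc k))) \<longlongrightarrow>
      (deriv ^^ Suc k) (deriv h) v / fact (Suc k) / real (Suc (Suc k))) (at v)"
    by (rule tendsto_divide[OF _ tendsto_const]) simp
  then have lim: "((\<lambda>u. deriv h u / (real (Suc (Suc k)) * (u - v) ^ Suc k)) \<longlongrightarrow>
      (deriv ^^ Suc (Suc k)) h v / fact (Suc (Suc k))) (at v)"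
    by (simp only: divide_divide_eq_left fact_Suc[of "Suc k"] funpow_Suc_right[of "Suc k"]
        o_apply of_nat_mult mult.commute)
  have ne: "eventually (\<lambda>u. u \<noteq> v) (at v)"
    by (simp add: eventually_at_filter)
  show ?case
  proof (rule lhopital[OF _ _ _ _ _ _ lim])
    show "(h \<longlongrightarrow> 0) (at v)"
      using DERIV_isCont[OF D[of v]] Suc.prems(2)[of 0] by (simp add: isCont_def)
    have "((\<lambda>u. (u - v) ^ Suc (Suc k)) \<longlongrightarrow> (v - v) ^ Suc (Suc k)) (at v)"
      by (intro tendsto_intros)
    then show "((\<lambda>u. (u - v) ^ Suc (Suc k)) \<longlongrightarrow> 0) (at v)"
      by simp
    show "\<forall>\<^sub>F u in at v. (u - v) ^ Suc (Suc k) \<noteq> 0"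
      using ne by eventually_elim simp
    show "\<forall>\<^sub>F u in at v. real (Suc (Suc k)) * (u - v) ^ Suc k \<noteq> 0"
      using ne by eventually_elim simp
    show "\<forall>\<^sub>F u in at v. (h has_real_derivative deriv h u) (at u)"
      by (simp add: D)
    show "\<forall>\<^sub>F u in at v. ((\<lambda>u. (u - v) ^ Suc (Suc k)) has_real_derivative
        real (Suc (Suc k)) * (u - v) ^ Suc k) (at u)"
      by (intro always_eventually allI) (rule derivative_eq_intros refl | simp)+
  qed
qed

section \<open>Scalar autonomous equations\<close>

text \<open>Extended real endpoints let one statement serve the bounded interval of the time map and
  the whole line of the integrating factor.\<close>

lemma continuous_antiderivative:
  fixes q :: "real \<Rightarrow> real"
  assumes "a < b" "\<And>x. ereal x \<in> {a<..<b} \<Longrightarrow> isCont q x"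
  obtains P where "\<And>x. ereal x \<in> {a<..<b} \<Longrightarrow> (P has_real_derivative q x) (at x)"
  using einterval_antiderivative[of a b q] assms
  by (auto simp: has_real_derivative_iff_has_vector_derivative)

text \<open>Caratheodory's form of the derivative turns the equation into a linear one,
  \<^term>\<open>W' = Q * W\<close> for \<^term>\<open>W = (\<lambda>z. U z - c)\<close> with continuous \<^term>\<open>Q\<close>.\<close>

lemma autonomous_ode_equilibrium:
  fixes U F :: "real \<Rightarrow> real"
  assumes U: "\<And>z. (U has_real_derivative F (U z)) (at z)"
    and F: "\<And>u. isCont F u" "(F has_real_derivative D) (at c)" "F c = 0"
    and "U z0 = c"
  shows "U z = c"
proof -
  obtain q where q: "\<And>u. F u = q u * (u - c)" "isCont q c"
    using F by (auto simp: CARAT_DERIV)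
  \<comment> \<open>Caratheodory's form gives continuity of \<open>q\<close> at \<open>c\<close>
    only; elsewhere \<open>q\<close> is forced to be the quotient
    \<open>F u / (u - c)\<close>.\<close>
  have "isCont q u" for u
  proof (cases "u = c")
    case False
    have "isCont (\<lambda>u. F u / (u - c)) u"
      using F(1) False by (intro continuous_intros) auto
    moreover have "eventually (\<lambda>u. F u / (u - c) = q u) (nhds u)"
      using t1_space_nhds[OF False] by eventually_elim (simp add: q)
    ultimately show ?thesis
      using isCont_cong by force
  qed (use q in simp)
  then have "isCont (\<lambda>z. q (U z)) x" for x
    using DERIV_isCont[OF U] isCont_o2 by blast
  then obtain P where P: "\<And>x. (P has_real_derivative q (U x)) (at x)"
    using continuous_antiderivative[of "-\<infinity>" \<infinity> "\<lambda>z. q (U z)"] by auto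
  \<comment> \<open>\<open>exp (- P z)\<close> is the integrating factor of the linear equation; the
    resulting constant is 0 because \<open>U z0 = c\<close>.\<close>
  have "((\<lambda>z. (U z - c) * exp (- P z)) has_real_derivative 0) (at x)" for x
    by (rule derivative_eq_intros U P refl)+ (simp add: q algebra_simps)
  then have "(U z - c) * exp (- P z) = (U z0 - c) * exp (- P z0)"
    by (intro DERIV_isconst_all) blast
  with \<open>U z0 = c\<close> show ?thesis by simp
qed

text \<open>Separation of variables: \<open>H u\<close> is, up to a constant, the time at which a
  solution of \<open>U' = F(U)\<close> takes the value \<open>u\<close>.\<close>

lemma time_map:
  fixes F :: "real \<Rightarrow> real"
  assumes "a < b" "\<And>u. a < u \<Longrightarrow> u < b \<Longrightarrow> isCont F u" "\<And>u. a < u \<Longrightarrow> u < b \<Longrightarrow> F u < 0"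
  obtains H where "\<And>u. a < u \<Longrightarrow> u < b \<Longrightarrow> (H has_real_derivative inverse (F u)) (at u)"
    "\<And>u v. a < u \<Longrightarrow> u < v \<Longrightarrow> v < b \<Longrightarrow> H v < H u"
proof -
  have "isCont (\<lambda>u. inverse (F u)) u" if "a < u" "u < b" for u
    using assms(2,3)[OF that] by (intro continuous_intros) auto
  then obtain H where H: "\<And>u. a < u \<Longrightarrow> u < b \<Longrightarrow> (H has_real_derivative inverse (F u)) (at u)"
    using continuous_antiderivative[of "ereal a" "ereal b" "\<lambda>u. inverse (F u)"] assms(1)
    by (metis greaterThanLessThan_iff less_ereal.simps(1))
  have "H v < H u" if "a < u" "u < v" "v < b" for u v
  proof (rule DERIV_neg_imp_decreasing[OF that(2)])
    fix x assume "u \<le> x" "x \<le> v"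
    then have "a < x" "x < b" using that by auto
    then show "\<exists>y. (H has_real_derivative y) (at x) \<and> y < 0"
      using H assms(3) by (metis negative_imp_inverse_negative)
  qed
  with H show ?thesis using that by blast
qed

text \<open>\<open>H (X z) - z\<close> is constant along every solution \<open>X\<close> between
  \<open>a\<close> and \<open>b\<close>. The shift is the difference of the two constants, and
  injectivity of \<open>H\<close> turns equal times into equal values.\<close>

lemma autonomous_ode_unique_up_to_shift:
  fixes F :: "real \<Rightarrow> real"
  assumes F: "a < b" "\<And>u. a < u \<Longrightarrow> u < b \<Longrightarrow> isCont F u" "\<And>u. a < u \<Longrightarrow> u < b \<Longrightarrow> F u < 0"
    and U: "\<And>z. (U has_real_derivative F (U z)) (at z)" "\<And>z. a < U z" "\<And>z. U z < b"
    and V: "\<And>z. (V has_real_derivative F (V z)) (at z)" "\<And>z. a < V z" "\<And>z. V z < b"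
  shows "\<exists>c. \<forall>z. V z = U (z + c)"
proof -
  obtain H where H: "\<And>u. a < u \<Longrightarrow> u < b \<Longrightarrow> (H has_real_derivative inverse (F u)) (at u)"
    "\<And>u v. a < u \<Longrightarrow> u < v \<Longrightarrow> v < b \<Longrightarrow> H v < H u"
    using time_map[OF F] by metis
  have time: "H (X z) = z + H (X 0)"
    if X: "\<And>z. (X has_real_derivative F (X z)) (at z)" "\<And>z. a < X z" "\<And>z. X z < b" for X z
  proof -
    have "((\<lambda>z. H (X z) - z) has_real_derivative 0) (at z)" for z
      by (rule derivative_eq_intros DERIV_chain2[OF H(1)] X refl)+
        (use F(3)[OF X(2,3)[of z]] in simp)
    then have "H (X z) - z = H (X 0) - 0"
      by (intro DERIV_isconst_all) blast
    then show ?thesis by simp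
  qed
  have "V z = U (z + (H (V 0) - H (U 0)))" for z
  proof -
    have "H (V z) = H (U (z + (H (V 0) - H (U 0))))"
      using time[OF U, of "z + (H (V 0) - H (U 0))"] time[OF V, of z] by linarith
    then show ?thesis
      using H(2) U(2,3) V(2,3) by (metis less_irrefl linorder_neqE_linordered_idom)
  qed
  then show ?thesis by blast
qed

text \<open>The linear bounds on \<^term>\<open>F\<close> make the time map diverge at both ends, so that its inverse
  is defined on the whole line.\<close>

lemma autonomous_ode_connecting_orbit:
  fixes F :: "real \<Rightarrow> real"
  assumes F: "a < b" "\<And>u. a < u \<Longrightarrow> u < b \<Longrightarrow> isCont F u" "\<And>u. a < u \<Longrightarrow> u < b \<Longrightarrow> F u < 0"
    and K: "\<And>u. a < u \<Longrightarrow> u < b \<Longrightarrow> - F u \<le> K * (u - a)"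
           "\<And>u. a < u \<Longrightarrow> u < b \<Longrightarrow> - F u \<le> K * (b - u)"
  obtains U where "\<And>z. a < U z" "\<And>z. U z < b"
    "\<And>z. (U has_real_derivative F (U z)) (at z)" "(U \<longlongrightarrow> a) at_top" "(U \<longlongrightarrow> b) at_bot"
proof -
  obtain H where H: "\<And>u. a < u \<Longrightarrow> u < b \<Longrightarrow> (H has_real_derivative inverse (F u)) (at u)"
    and anti: "\<And>u v. a < u \<Longrightarrow> u < v \<Longrightarrow> v < b \<Longrightarrow> H v < H u"
    using time_map[OF F] by metis
  define m where "m = (a + b) / 2"
  have m: "a < m" "m < b" using F(1) by (auto simp: m_def)
  have Kpos: "K > 0"
    using F(3)[OF m] K(1)[OF m] m by (smt (verit) zero_less_mult_iff)
  have inv_le: "inverse (F u) \<le> - inverse (K * d)" if "- F u \<le> K * d" "F u < 0" for u d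
    using le_imp_inverse_le[of "- F u" "K * d"] that by simp
  have high: "\<exists>u. a < u \<and> u < b \<and> H u > y" for y
  proof -
    \<comment> \<open>Shrinking the distance to \<open>a\<close> by the factor
      \<open>exp (- t)\<close> lowers \<open>ln (u - a)\<close> by \<open>t\<close>. Since
      \<open>H x + ln (x - a) / K\<close> does not increase in \<open>x\<close>, \<open>H\<close>
      rises by at least \<open>t / K\<close>, which exceeds the gap between \<open>y\<close> and
      \<open>H m\<close>.\<close>
    define t where "t = K * (\<bar>y - H m\<bar> + 1)"
    have t: "t > 0" using Kpos by (auto simp: t_def)
    define u where "u = a + (m - a) * exp (- t)"
    have "0 < (m - a) * exp (- t)" "(m - a) * exp (- t) < (m - a)"
      using m t by auto
    then have u: "a < u" "u \<le> m"
      unfolding u_def by argo+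
    have "H m + ln (m - a) / K \<le> H u + ln (u - a) / K"
    proof (rule DERIV_nonpos_imp_nonincreasing[OF u(2)])
      fix x assume x: "u \<le> x" "x \<le> m"
      then have x': "a < x" "x < b" using u m by auto
      have "((\<lambda>x. ln (x - a) / K) has_real_derivative inverse (K * (x - a))) (at x)"
        using x' Kpos by (auto intro!: derivative_eq_intros simp: inverse_eq_divide)
      from DERIV_add[OF H[OF x'] this]
      have "((\<lambda>x. H x + ln (x - a) / K) has_real_derivative inverse (F x) + inverse (K * (x - a))) (at x)" .
      then show "\<exists>y. ((\<lambda>x. H x + ln (x - a) / K) has_real_derivative y) (at x) \<and> y \<le> 0"
        using inv_le[OF K(1)[OF x'] F(3)[OF x']] by (intro exI conjI) (assumption, simp)
    qed
    moreover have "ln (u - a) = ln (m - a) - t"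
      using m by (simp add: u_def ln_mult)
    ultimately have "H m + t / K \<le> H u"
      by (simp add: diff_divide_distrib)
    moreover have "t / K = \<bar>y - H m\<bar> + 1" using Kpos by (simp add: t_def)
    ultimately show ?thesis using u m by (intro exI[of _ u]) auto
  qed
  \<comment> \<open>The mirror image at \<open>b\<close>: the distance to \<open>b\<close> shrinks
    by \<open>exp (- t)\<close>, which lowers \<open>H\<close> by at least
    \<open>t / K\<close>.\<close>
  have low: "\<exists>u. a < u \<and> u < b \<and> H u < y" for y
  proof -
    define t where "t = K * (\<bar>y - H m\<bar> + 1)"
    have t: "t > 0" using Kpos by (auto simp: t_def)
    define u where "u = b - (b - m) * exp (- t)"
    have "0 < (b - m) * exp (- t)" "(b - m) * exp (- t) < (b - m)"
      using m t by auto
    then have u: "u < b" "m \<le> u"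
      unfolding u_def by argo+
    have "H u - ln (b - u) / K \<le> H m - ln (b - m) / K"
    proof (rule DERIV_nonpos_imp_nonincreasing[OF u(2)])
      fix x assume x: "m \<le> x" "x \<le> u"
      then have x': "a < x" "x < b" using u m by auto
      have "((\<lambda>x. ln (b - x) / K) has_real_derivative - inverse (K * (b - x))) (at x)"
        using x' Kpos by (auto intro!: derivative_eq_intros simp: inverse_eq_divide)
      from DERIV_diff[OF H[OF x'] this]
      have "((\<lambda>x. H x - ln (b - x) / K) has_real_derivative inverse (F x) + inverse (K * (b - x))) (at x)"
        by simp
      then show "\<exists>y. ((\<lambda>x. H x - ln (b - x) / K) has_real_derivative y) (at x) \<and> y \<le> 0"
        using inv_le[OF K(2)[OF x'] F(3)[OF x']] by (intro exI conjI) (assumption, simp)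
    qed
    moreover have "ln (b - u) = ln (b - m) - t"
      using m by (simp add: u_def ln_mult)
    ultimately have "H u \<le> H m - t / K"
      by (simp add: diff_divide_distrib)
    moreover have "t / K = \<bar>y - H m\<bar> + 1" using Kpos by (simp add: t_def)
    ultimately show ?thesis using u m by (intro exI[of _ u]) auto
  qed
  have "\<exists>u. a < u \<and> u < b \<and> H u = y" for y
  proof -
    obtain u v where uv: "a < u" "u < b" "y < H u" "a < v" "v < b" "H v < y"
      using high[of y] low[of y] by blast
    have "u \<le> v"
      using uv anti[of v u] by (cases "u \<le> v") auto
    moreover have "\<forall>x. u \<le> x \<and> x \<le> v \<longrightarrow> isCont H x"
      using uv H DERIV_isCont by (meson less_le_trans le_less_trans)
    ultimately obtain x where "u \<le> x" "x \<le> v" "H x = y"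
      using IVT2[of H v y u] uv by auto
    then show ?thesis using uv by (intro exI[of _ x]) auto
  qed
  then obtain U where U: "\<And>z. a < U z" "\<And>z. U z < b" "\<And>z. H (U z) = z"
    by metis
  have less_iff: "U z < u \<longleftrightarrow> H u < z" if "a < u" "u < b" for z u
    using anti[OF U(1)[of z], of u] anti[of u "U z"] U that
    by (metis less_asym linorder_neqE_linordered_idom)
  have gt_iff: "u < U z \<longleftrightarrow> z < H u" if "a < u" "u < b" for z u
    using anti[OF U(1)[of z], of u] anti[of u "U z"] U that
    by (metis less_asym linorder_neqE_linordered_idom)
  have UH: "U (H u) = u" if "a < u" "u < b" for u
    using less_iff[OF that] gt_iff[OF that] by (metis less_irrefl linorder_neqE_linordered_idom)
  have deriv: "(U has_real_derivative F (U z)) (at z)" for z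
  proof -
    obtain d where d: "d > 0" "a < U z - d" "U z + d < b"
    proof
      show "min (U z - a) (b - U z) / 2 > 0" using U by auto
    qed (use U(1)[of z] U(2)[of z] in \<open>auto simp: min_def field_simps\<close>)
    have "isCont U (H (U z))"
    proof (rule isCont_inverse_function[where f = H and x = "U z", OF d(1)])
      have "a < x" "x < b" if "\<bar>x - U z\<bar> \<le> d" for x
        using that d by auto
      then show "\<And>x. \<bar>x - U z\<bar> \<le> d \<Longrightarrow> U (H x) = x"
        "\<And>x. \<bar>x - U z\<bar> \<le> d \<Longrightarrow> isCont H x"
        using UH H DERIV_isCont by blast+
    qed
    then have "isCont U z" by (simp add: U)
    have "(U has_real_derivative inverse (inverse (F (U z)))) (at z)"
      by (rule DERIV_inverse_function[where f = H and a = "z - 1" and b = "z + 1"])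
        (use F(3)[OF U(1,2)[of z]] U \<open>isCont U z\<close> in \<open>auto intro: H\<close>)
    then show ?thesis by simp
  qed
  have "(U \<longlongrightarrow> a) at_top"
  proof (rule order_tendstoI)
    fix y assume "y > a"
    define u where "u = min y m"
    have "a < u" "u < b" "u \<le> y" using \<open>y > a\<close> m by (auto simp: u_def)
    then have "U z < y" if "H u < z" for z
      using less_iff[of u z] that by linarith
    then show "\<forall>\<^sub>F z in at_top. U z < y"
      by (rule eventually_mono[OF eventually_gt_at_top[of "H u"]])
  qed (use U in \<open>auto intro!: always_eventually intro: less_trans\<close>)
  moreover have "(U \<longlongrightarrow> b) at_bot"
  proof (rule order_tendstoI)
    fix y assume "y < b"
    define u where "u = max y m"
    have "a < u" "u < b" "y \<le> u" using \<open>y < b\<close> m by (auto simp: u_def)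
    then have "y < U z" if "z < H u" for z
      using gt_iff[of u z] that by linarith
    then show "\<forall>\<^sub>F z in at_bot. y < U z"
      by (rule eventually_mono[OF eventually_gt_at_bot[of "H u"]])
  qed (use U in \<open>auto intro!: always_eventually intro: less_trans\<close>)
  ultimately show ?thesis
    using that U deriv by blast
qed

text \<open>\<open>U z / z\<close> tends to \<open>D\<close> by l'Hopital, and to 0 because
  \<open>U\<close> converges.\<close>

lemma derivative_limit_at_top:
  fixes U :: "real \<Rightarrow> real"
  assumes "\<And>z. (U has_real_derivative U' z) (at z)" "(U \<longlongrightarrow> l) at_top" "(U' \<longlongrightarrow> D) at_top"
  shows "D = 0"
proof -
  have "((\<lambda>z. U z / z) \<longlongrightarrow> D) at_top"
    by (rule lhospital_at_top_at_top[where f' = U' and g' = "\<lambda>_. 1"])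
      (use assms in \<open>auto simp: filterlim_ident intro!: derivative_eq_intros\<close>)
  moreover have "((\<lambda>z. U z / z) \<longlongrightarrow> 0) at_top"
    by (rule tendsto_divide_0[OF assms(2)]) (simp add: filterlim_ident filterlim_at_top_imp_at_infinity)
  ultimately show ?thesis
    by (rule tendsto_unique[OF trivial_limit_at_top_linorder])
qed

section \<open>Rates of decay\<close>

lemma comparable_at_bot:
  "comparable at_bot A B \<longleftrightarrow> comparable at_top (\<lambda>z. A (- z)) (\<lambda>z. B (- z))"
  unfolding comparable_def at_bot_mirror eventually_filtermap ..

lemma algebraic_decay:
  fixes W R :: "real \<Rightarrow> real"
  assumes pos: "\<And>z. 0 < W z"
    and ode: "\<And>z. (W has_real_derivative - (R z * W z ^ Suc m)) (at z)"
    and m: "0 < m" and R: "(R \<longlongrightarrow> c) at_top" "0 < c"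
  shows "comparable at_top W (\<lambda>z. \<bar>z\<bar> powr (- (1 / real m)))"
proof -
  define Y where "Y = (\<lambda>z. inverse (W z ^ m))"
  have Ypos: "Y z > 0" for z
    using pos by (simp add: Y_def)
  have Y: "(Y has_real_derivative m * R z) (at z)" for z
  proof -
    obtain n where n: "m = Suc n" using m by (cases m) auto
    have "(Y has_real_derivative
        - (real m * W z ^ (m - Suc 0) * - (R z * W z ^ Suc m) * inverse ((W z ^ m)\<^sup>2))) (at z)"
      unfolding Y_def
      by (rule derivative_eq_intros ode refl)+ (use pos[of z] in \<open>auto simp: power2_eq_square\<close>)
    moreover have "- (real m * W z ^ (m - Suc 0) * - (R z * W z ^ Suc m) * inverse ((W z ^ m)\<^sup>2)) = m * R z"
      using pos[of z] by (simp add: n power2_eq_square field_simps)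
    ultimately show ?thesis by (simp only:)
  qed
  have "eventually (\<lambda>z. c / 2 < R z) at_top" "eventually (\<lambda>z. R z < 2 * c) at_top"
    by (intro order_tendstoD[OF R(1)]; use R(2) in simp)+
  then have "eventually (\<lambda>z. c / 2 < R z \<and> R z < 2 * c) at_top"
    by eventually_elim simp
  then obtain Z0 where Z0: "\<And>z. z \<ge> Z0 \<Longrightarrow> c / 2 < R z \<and> R z < 2 * c"
    by (auto simp: eventually_at_top_linorder)
  define Z where "Z = max Z0 1"
  have Z: "Z \<ge> 1" "\<And>z. z \<ge> Z \<Longrightarrow> c / 2 \<le> R z" "\<And>z. z \<ge> Z \<Longrightarrow> R z \<le> 2 * c"
    using Z0 by (auto simp: Z_def less_imp_le)
  \<comment> \<open>\<open>Y\<close> grows at least at rate \<open>m * c / 2\<close>; half of this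
    is given up because \<open>z - Z \<ge> z / 2\<close> for \<open>z \<ge> 2 * Z\<close>. The upper
    rate \<open>2 * m * c\<close> is doubled to absorb the initial value \<open>Y Z\<close>.\<close>
  define \<alpha> \<beta> where "\<alpha> = real m * c / 4" and "\<beta> = 4 * real m * c"
  have ab: "\<alpha> > 0" "\<beta> > 0" using m R by (auto simp: \<alpha>_def \<beta>_def)
  have bounds: "\<alpha> * z \<le> Y z \<and> Y z \<le> \<beta> * z" if z: "z \<ge> 2 * Z" "z \<ge> Y Z / (2 * real m * c)" for z
  proof -
    have "Z \<le> z" using z Z by linarith
    have "Y Z - (real m * c / 2) * Z \<le> Y z - (real m * c / 2) * z"
    proof (rule DERIV_nonneg_imp_nondecreasing[OF \<open>Z \<le> z\<close>])
      fix x assume "Z \<le> x"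
      have "((\<lambda>x. Y x - (real m * c / 2) * x) has_real_derivative real m * R x - real m * c / 2) (at x)"
        by (rule derivative_eq_intros Y refl | simp)+
      moreover have "real m * R x - real m * c / 2 \<ge> 0"
        using mult_left_mono[OF Z(2)[OF \<open>Z \<le> x\<close>], of "real m"] by simp
      ultimately show "\<exists>y. ((\<lambda>x. Y x - (real m * c / 2) * x) has_real_derivative y) (at x) \<and> 0 \<le> y"
        by blast
    qed
    then have "real m * c / 2 * (z - Z) \<le> Y z"
      using Ypos[of Z] by (simp add: right_diff_distrib)
    moreover have "real m * c / 2 * (z / 2) \<le> real m * c / 2 * (z - Z)"
      using m R z by (intro mult_left_mono) auto
    moreover have "\<alpha> * z = real m * c / 2 * (z / 2)"
      by (simp add: \<alpha>_def)
    ultimately have lower: "\<alpha> * z \<le> Y z"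
      by argo
    have "Y z - (2 * real m * c) * z \<le> Y Z - (2 * real m * c) * Z"
    proof (rule DERIV_nonpos_imp_nonincreasing[OF \<open>Z \<le> z\<close>])
      fix x assume "Z \<le> x"
      have "((\<lambda>x. Y x - (2 * real m * c) * x) has_real_derivative real m * R x - 2 * real m * c) (at x)"
        by (rule derivative_eq_intros Y refl | simp)+
      moreover have "real m * R x - 2 * real m * c \<le> 0"
        using mult_left_mono[OF Z(3)[OF \<open>Z \<le> x\<close>], of "real m"] by simp
      ultimately show "\<exists>y. ((\<lambda>x. Y x - (2 * real m * c) * x) has_real_derivative y) (at x) \<and> y \<le> 0"
        by blast
    qed
    moreover have "2 * real m * c * Z \<ge> 0" using m R Z by simp
    moreover have "Y Z \<le> 2 * real m * c * z"
      using z(2) m R by (simp add: field_simps)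
    ultimately have "Y z \<le> \<beta> * z"
      unfolding \<beta>_def by argo
    with lower show ?thesis by simp
  qed
  define p where "p = - (1 / real m)"
  have p: "p \<le> 0" by (simp add: p_def)
  have WY: "W z = Y z powr p" for z
  proof -
    have "Y z = W z powr (- real m)"
      using pos[of z] by (simp add: Y_def powr_minus powr_realpow)
    then show ?thesis
      using m pos[of z] by (simp add: powr_powr p_def)
  qed
  \<comment> \<open>As \<open>p \<le> 0\<close>, taking powers reverses the bounds on
    \<open>Y\<close>: \<open>\<alpha>\<close> controls \<open>W\<close> from above and
    \<open>\<beta>\<close> from below.\<close>
  define C where "C = max (\<alpha> powr p) (inverse (\<beta> powr p))"
  have C: "C > 0" "\<alpha> powr p \<le> C" "inverse C \<le> \<beta> powr p"
  proof -
    show "C > 0" using ab by (simp add: C_def less_max_iff_disj)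
    show "\<alpha> powr p \<le> C" by (simp add: C_def)
    have "inverse C \<le> inverse (inverse (\<beta> powr p))"
      using ab by (intro le_imp_inverse_le) (auto simp: C_def)
    then show "inverse C \<le> \<beta> powr p" by simp
  qed
  have "eventually (\<lambda>z. z \<ge> max (2 * Z) (Y Z / (2 * real m * c))) at_top"
    by (rule eventually_ge_at_top)
  then have "eventually (\<lambda>z. inverse C * \<bar>z\<bar> powr p \<le> W z \<and> W z \<le> C * \<bar>z\<bar> powr p) at_top"
  proof eventually_elim
    case (elim z)
    then have z: "z > 0" and b: "\<alpha> * z \<le> Y z" "Y z \<le> \<beta> * z"
      using bounds[of z] Z by auto
    have "W z \<le> (\<alpha> * z) powr p"
      unfolding WY using z ab b p by (intro powr_mono2') auto
    also have "\<dots> = \<alpha> powr p * z powr p"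
      using z ab by (simp add: powr_mult)
    also have "\<dots> \<le> C * z powr p"
      using C by (intro mult_right_mono) auto
    finally have upper: "W z \<le> C * z powr p" .
    have "inverse C * z powr p \<le> \<beta> powr p * z powr p"
      using C by (intro mult_right_mono) auto
    also have "\<dots> = (\<beta> * z) powr p"
      using z ab by (simp add: powr_mult)
    also have "\<dots> \<le> W z"
      unfolding WY using z ab b p Ypos[of z] by (intro powr_mono2') auto
    finally show ?case using upper z by simp
  qed
  then show ?thesis
    using C(1) unfolding comparable_def p_def by blast
qed

text \<open>Since the derivative of \<^term>\<open>- W\<close> dominates a multiple of \<^term>\<open>W\<close>, adding a multiple of \<^term>\<open>W\<close> to
  \<^term>\<open>ln (W z) + \<mu> * z\<close> or subtracting one makes it monotone, decreasing
  or increasing respectively; hence it is bounded.\<close>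

lemma exponential_decay:
  fixes W R :: "real \<Rightarrow> real"
  assumes pos: "\<And>z. 0 < W z"
    and ode: "\<And>z. (W has_real_derivative - (R z * W z)) (at z)"
    and lim: "(W \<longlongrightarrow> 0) at_top"
    and R: "eventually (\<lambda>z. \<bar>R z - \<mu>\<bar> \<le> K * W z) at_top" "0 < \<mu>"
  shows "comparable at_top W (\<lambda>z. exp (- \<mu> * \<bar>z\<bar>))"
proof -
  have "((\<lambda>z. K * W z) \<longlongrightarrow> K * 0) at_top"
    by (intro tendsto_intros lim)
  then have "eventually (\<lambda>z. K * W z < \<mu> / 2) at_top"
    using R(2) by (intro order_tendstoD) auto
  with R(1) eventually_ge_at_top[of 0]
  have "eventually (\<lambda>z. \<bar>R z - \<mu>\<bar> \<le> K * W z \<and> K * W z \<le> \<mu> / 2 \<and> 0 \<le> z) at_top"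
    by eventually_elim simp
  then obtain Z where Z: "\<And>z. z \<ge> Z \<Longrightarrow> \<bar>R z - \<mu>\<bar> \<le> K * W z \<and> K * W z \<le> \<mu> / 2 \<and> 0 \<le> z"
    by (auto simp: eventually_at_top_linorder)
  have "K \<ge> 0"
  proof -
    have "0 \<le> K * W Z" using Z[of Z] by linarith
    then show ?thesis using pos[of Z] by (simp add: zero_le_mult_iff)
  qed
  \<comment> \<open>Past \<open>Z\<close> the coefficient \<open>R\<close> is at least
    \<open>\<mu> / 2\<close>, so with this \<open>D\<close> the rate \<open>D * (R * W)\<close> at
    which \<open>D * W\<close> decreases outweighs \<open>K * W\<close>, the bound on the derivative
    of \<open>A\<close>.\<close>
  define D where "D = 2 * K / \<mu>"
  have D: "D \<ge> 0" using \<open>K \<ge> 0\<close> R(2) by (simp add: D_def)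
  define A where "A = (\<lambda>z. ln (W z) + \<mu> * z)"
  have A: "(A has_real_derivative \<mu> - R z) (at z)" for z
    unfolding A_def
    by (rule derivative_eq_intros ode pos refl)+ (use pos[of z] in simp)
  have DRW: "K * W x \<le> D * (R x * W x)" if "x \<ge> Z" for x
  proof -
    have "\<mu> / 2 \<le> R x" using Z[OF that] by linarith
    then have "D * W x * (\<mu> / 2) \<le> D * W x * R x"
      using D pos[of x] by (intro mult_left_mono) auto
    moreover have "D * W x * (\<mu> / 2) = K * W x"
      using R(2) by (simp add: D_def)
    moreover have "D * W x * R x = D * (R x * W x)"
      by simp
    ultimately show ?thesis by argo
  qed
  have bound: "\<bar>A z\<bar> \<le> \<bar>A Z\<bar> + D * W Z" if "z \<ge> Z" for z
  proof -
    have "A Z - D * W Z \<le> A z - D * W z"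
    proof (rule DERIV_nonneg_imp_nondecreasing[OF that])
      fix x assume x: "Z \<le> x"
      have "((\<lambda>x. A x - D * W x) has_real_derivative \<mu> - R x + D * (R x * W x)) (at x)"
        by (rule derivative_eq_intros A ode refl | simp)+
      moreover have "\<mu> - R x + D * (R x * W x) \<ge> 0"
        using DRW[OF x] Z[OF x] by linarith
      ultimately show "\<exists>y. ((\<lambda>x. A x - D * W x) has_real_derivative y) (at x) \<and> 0 \<le> y"
        by blast
    qed
    moreover have "A z + D * W z \<le> A Z + D * W Z"
    proof (rule DERIV_nonpos_imp_nonincreasing[OF that])
      fix x assume x: "Z \<le> x"
      have "((\<lambda>x. A x + D * W x) has_real_derivative \<mu> - R x - D * (R x * W x)) (at x)"
        by (rule derivative_eq_intros A ode refl | simp)+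
      moreover have "\<mu> - R x - D * (R x * W x) \<le> 0"
        using DRW[OF x] Z[OF x] by linarith
      ultimately show "\<exists>y. ((\<lambda>x. A x + D * W x) has_real_derivative y) (at x) \<and> y \<le> 0"
        by blast
    qed
    moreover have "0 \<le> D * W z" using D pos[of z] by simp
    ultimately show ?thesis by linarith
  qed
  define B where "B = \<bar>A Z\<bar> + D * W Z"
  have "eventually (\<lambda>z. inverse (exp B) * exp (- \<mu> * \<bar>z\<bar>) \<le> W z \<and> W z \<le> exp B * exp (- \<mu> * \<bar>z\<bar>)) at_top"
    using eventually_ge_at_top[of Z]
  proof eventually_elim
    case (elim z)
    have "W z = exp (A z - \<mu> * z)" using pos[of z] by (simp add: A_def)
    moreover have "z \<ge> 0" using Z elim by blast
    moreover have "\<bar>A z\<bar> \<le> B" using bound[OF elim] by (simp add: B_def)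
    ultimately show ?case
      by (auto simp: mult_exp_exp simp flip: exp_minus)
  qed
  then show ?thesis
    unfolding comparable_def using exp_gt_zero by blast
qed

section \<open>Shock profiles\<close>

text \<open>\<open>E\<close> is the profile equation integrated once, hence constant.
  \<open>L\<close>, the limit of the flux \<open>q\<close> at -infinity, measures how far this
  constant is from the one in \<open>gfun f s um\<close>. As \<open>U' = q * U\<close> tends to
  \<open>L * um\<close> while \<open>U\<close> converges, \<open>L * um = 0\<close>.\<close>

lemma shock_profile_ode:
  assumes sp: "shock_profile f s um U" and f: "\<And>u. f differentiable (at u)" and "0 < um"
  shows "0 < U z" "(U has_real_derivative U z * gfun f s um (U z)) (at z)"
proof -
  \<comment> \<open>Positivity is a part of \<open>pde_solution\<close>, read off here at time
    0.\<close>
  have pos: "0 < U z" for z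
    using sp unfolding shock_profile_def pde_solution_def
    by (metis mult_zero_right diff_zero)
  then show "0 < U z" .
  have "C_k 2 U"
    using sp by (simp add: shock_profile_def)
  then have "\<And>z. U differentiable (at z)" "\<And>z. deriv U differentiable (at z)"
    by (simp_all add: numeral_2_eq_2 C_k_Suc)
  then have U: "(U has_real_derivative deriv U z) (at z)"
    and U2: "(deriv U has_real_derivative deriv (deriv U) z) (at z)" for z
    using DERIV_deriv_iff_real_differentiable by blast+
  define q where "q = (\<lambda>z. deriv U z / U z)"
  have q: "(q has_real_derivative deriv q z) (at z)" for z
  proof -
    have "(q has_real_derivative (deriv (deriv U) z * U z - deriv U z * deriv U z) / (U z * U z)) (at z)"
      unfolding q_def using pos[of z] by (intro DERIV_divide U U2) simp
    then show ?thesis using DERIV_imp_deriv by metis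
  qed
  have fU: "((\<lambda>y. f (U y)) has_real_derivative deriv (\<lambda>y. f (U y)) z) (at z)" for z
  proof -
    have "(f has_real_derivative deriv f (U z)) (at (U z))"
      using f DERIV_deriv_iff_real_differentiable by blast
    from DERIV_chain2[OF this U] show ?thesis
      using DERIV_imp_deriv by metis
  qed
  define E where "E = (\<lambda>z. f (U z) - s * U z - q z)"
  have "(E has_real_derivative 0) (at z)" for z
  proof -
    have "(E has_real_derivative deriv (\<lambda>y. f (U y)) z - s * deriv U z - deriv q z) (at z)"
      unfolding E_def by (rule derivative_eq_intros fU U q refl)+ simp
    moreover have "- s * deriv U z - deriv q z + deriv (\<lambda>y. f (U y)) z = 0"
      using sp unfolding shock_profile_def q_def by blast
    ultimately show ?thesis by (simp add: algebra_simps)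
  qed
  then have E: "E z = E 0" for z
    by (intro DERIV_isconst_all) blast
  define L where "L = f um - s * um - E 0"
  have q_eq: "q z = f (U z) - s * U z - E 0" for z
    using E[of z] by (simp add: E_def)
  have bot: "(U \<longlongrightarrow> um) at_bot"
    using sp by (simp add: shock_profile_def)
  have "isCont f um"
    using f differentiable_imp_continuous_within by blast
  then have "(q \<longlongrightarrow> L) at_bot"
    unfolding q_eq[abs_def] L_def
    by (intro tendsto_intros bot isCont_tendsto_compose[OF _ bot])
  then have "((\<lambda>z. q z * U z) \<longlongrightarrow> L * um) at_bot"
    by (intro tendsto_intros bot)
  moreover have dU: "deriv U z = q z * U z" for z
    using pos[of z] by (simp add: q_def)
  ultimately have "(deriv U \<longlongrightarrow> L * um) at_bot"
    by (simp add: dU[abs_def])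
  then have lim': "((\<lambda>z. - deriv U (- z)) \<longlongrightarrow> - (L * um)) at_top"
    by (intro tendsto_intros filterlim_compose[OF _ filterlim_uminus_at_bot_at_top])
  have lim: "((\<lambda>z. U (- z)) \<longlongrightarrow> um) at_top"
    by (intro filterlim_compose[OF bot filterlim_uminus_at_bot_at_top])
  have "((\<lambda>z. U (- z)) has_real_derivative - deriv U (- z)) (at z)" for z
    using DERIV_chain2[OF U DERIV_minus[OF DERIV_ident]] by simp
  then have "- (L * um) = 0"
    by (rule derivative_limit_at_top[OF _ lim lim'])
  then have "L = 0" using \<open>0 < um\<close> by simp
  then have "q z = gfun f s um (U z)" for z
    unfolding q_eq gfun_def L_def right_diff_distrib by linarith
  then show "(U has_real_derivative U z * gfun f s um (U z)) (at z)"
    using U[of z] dU[of z] by (metis mult.commute)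
qed

lemma gfun_ode_rhs_derivative:
  assumes "f differentiable (at u)"
  shows "((\<lambda>u. u * gfun f s v u) has_real_derivative gfun f s v u + u * (deriv f u - s)) (at u)"
  by (rule derivative_eq_intros gfun_has_derivative[OF assms] refl | simp)+

text \<open>The choice of base point makes \<open>um\<close> itself a zero of
  \<open>gfun f s um\<close>. A value at or above \<open>um\<close> would have to cross
  \<open>um\<close> on the way down to 0, and a nonconstant profile cannot meet a zero.\<close>

lemma shock_profile_monotone:
  assumes sp: "shock_profile f s um U" and f: "\<And>u. f differentiable (at u)" and "0 < um"
  shows "U z < um" "0 < u \<Longrightarrow> u < um \<Longrightarrow> gfun f s um u < 0"
proof -
  note ode = shock_profile_ode(2)[OF sp f \<open>0 < um\<close>]
  have top: "(U \<longlongrightarrow> 0) at_top" and bot: "(U \<longlongrightarrow> um) at_bot" and nc: "\<not> (\<exists>c. \<forall>z. U z = c)"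
    using sp by (auto simp: shock_profile_def)
  note F = gfun_ode_rhs_derivative[OF f]
  have no_zero: "gfun f s um (U z) \<noteq> 0" for z
  proof
    assume "gfun f s um (U z) = 0"
    then have "U z * gfun f s um (U z) = 0" by simp
    from autonomous_ode_equilibrium[where F = "\<lambda>u. u * gfun f s um u",
        OF ode DERIV_isCont[OF F] F this refl]
    have "U y = U z" for y .
    with nc show False by blast
  qed
  have contU: "isCont U z" for z
    using ode DERIV_isCont by blast
  have cross: "\<exists>x\<ge>a. U x = u" if "u \<le> U a" "0 < u" for u a
  proof -
    have "eventually (\<lambda>z. U z < u \<and> a \<le> z) at_top"
      using order_tendstoD(2)[OF top \<open>0 < u\<close>] eventually_ge_at_top[of a] by eventually_elim simp
    then obtain b where "U b < u" "a \<le> b"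
      using eventually_happens by fastforce
    then show ?thesis
      using IVT2[of U b u a] that contU by auto
  qed
  show less: "U z < um" for z
  proof (rule ccontr)
    assume "\<not> U z < um"
    then obtain x where "U x = um"
      using cross[of um z] \<open>0 < um\<close> by auto
    then show False using no_zero[of x] by (simp add: gfun_def)
  qed
  \<comment> \<open>The earlier time \<open>a\<close>, at which \<open>U\<close> is above
    \<open>u\<close>, is recorded because it fixes the direction of the crossing; this is what a
    nondecreasing \<open>U\<close> would contradict.\<close>
  have attained: "\<exists>a x. a \<le> x \<and> u < U a \<and> U x = u" if "0 < u" "u < um" for u
  proof -
    obtain a where "u < U a"
      using order_tendstoD(1)[OF bot \<open>u < um\<close>] eventually_happens by fastforce
    then show ?thesis
      using cross[of u a] that by auto
  qed
  show "gfun f s um u < 0" if u: "0 < u" "u < um"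
  proof (rule ccontr)
    assume "\<not> gfun f s um u < 0"
    \<comment> \<open>Continuity without zeros gives \<open>g\<close> one sign on the whole
      interval, so a single nonnegative value makes it positive everywhere and \<open>U\<close>
      nondecreasing.\<close>
    have nz: "gfun f s um v \<noteq> 0" if "0 < v" "v < um" for v
      using attained[OF that] no_zero by metis
    have "connected (gfun f s um ` {0<..<um})"
      by (intro connected_continuous_image continuous_at_imp_continuous_on)
        (auto intro: DERIV_isCont[OF gfun_has_derivative[OF f]])
    then have pos: "gfun f s um v > 0" if "0 < v" "v < um" for v
      using connectedD_interval[of "gfun f s um ` {0<..<um}" "gfun f s um v" "gfun f s um u" 0]
        \<open>\<not> gfun f s um u < 0\<close> that u nz
      by (smt (verit) greaterThanLessThan_iff image_iff)
    obtain a x where ax: "a \<le> x" "u < U a" "U x = u"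
      using attained[OF u] by blast
    have "U a \<le> U x"
    proof (rule DERIV_nonneg_imp_nondecreasing[OF ax(1)])
      fix y
      have "0 \<le> U y * gfun f s um (U y)"
        using pos[of "U y"] less[of y] shock_profile_ode(1)[OF sp f \<open>0 < um\<close>, of y] by simp
      then show "\<exists>d. (U has_real_derivative d) (at y) \<and> 0 \<le> d"
        using ode by blast
    qed
    with ax show False by simp
  qed
qed

text \<open>\<open>F\<close> is C^1 because \<open>f\<close> is, so \<open>U' = F(U)\<close> makes
  \<open>U\<close> of class C^2. The flux \<open>U' / U\<close> is \<open>G(U)\<close>, with
  derivative \<open>(f'(U) - s) * F(U)\<close>, which cancels against \<open>- s * F(U)\<close> and
  \<open>f'(U) * F(U)\<close>.\<close>

lemma ode_solution_is_shock_profile: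
  assumes f: "C_k 1 f" and "0 < um" and pos: "\<And>z. 0 < U z"
    and ode: "\<And>z. (U has_real_derivative U z * gfun f s um (U z)) (at z)"
    and top: "(U \<longlongrightarrow> 0) at_top" and bot: "(U \<longlongrightarrow> um) at_bot"
  shows "shock_profile f s um U"
proof -
  define G where "G = gfun f s um"
  define F where "F = (\<lambda>u. u * G u)"
  define F' where "F' = (\<lambda>u. G u + u * (deriv f u - s))"
  have fd: "f differentiable (at u)" for u
    using f by (simp add: C_k_Suc)
  then have Df: "(f has_real_derivative deriv f u) (at u)" for u
    using DERIV_deriv_iff_real_differentiable by blast
  have G: "(G has_real_derivative deriv f u - s) (at u)" for u
    unfolding G_def by (rule gfun_has_derivative[OF fd])
  have F: "(F has_real_derivative F' u) (at u)" for u
    unfolding F_def F'_def G_def by (rule gfun_ode_rhs_derivative[OF fd])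
  have U: "(U has_real_derivative F (U z)) (at z)" for z
    using ode by (simp add: F_def G_def)
  have dU: "deriv U = (\<lambda>z. F (U z))"
    using U DERIV_imp_deriv by blast
  have ddU: "deriv (deriv U) = (\<lambda>z. F' (U z) * F (U z))"
    unfolding dU using DERIV_chain2[OF F U] DERIV_imp_deriv by blast
  have cont: "continuous_on UNIV U" "continuous_on UNIV G" "continuous_on UNIV F"
    using U G F by (meson DERIV_isCont continuous_at_imp_continuous_on)+
  have "continuous_on UNIV (deriv f)"
    using f by (simp add: C_k_def)
  then have "continuous_on UNIV F'"
    unfolding F'_def by (intro continuous_intros cont)
  then have "continuous_on UNIV (\<lambda>z. F' (U z) * F (U z))"
    using continuous_on_compose2[OF _ cont(1)] cont(3) by (intro continuous_on_mult) auto
  moreover have "U differentiable (at z)" "deriv U differentiable (at z)" for z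
    using U DERIV_chain2[OF F U] by (auto simp: dU real_differentiable_def)
  ultimately have "C_k 2 U"
    unfolding numeral_2_eq_2 C_k_Suc by (simp add: C_k_def ddU)
  moreover have "\<not> (\<exists>c. \<forall>z. U z = c)"
  proof
    assume "\<exists>c. \<forall>z. U z = c"
    then obtain c where "U = (\<lambda>_. c)" by blast
    with top bot have "c = 0" "c = um"
      by (simp_all add: tendsto_const_iff)
    with \<open>0 < um\<close> show False by simp
  qed
  moreover have shift: "((\<lambda>\<xi>. U (\<xi> - c)) has_real_derivative F (U (x - c))) (at x)" for x c
    using DERIV_chain2[OF U DERIV_diff[OF DERIV_ident DERIV_const]] by simp
  have "pde_solution f (\<lambda>x t. U (x - s * t))"
    unfolding pde_solution_def
  proof (intro allI conjI pos)
    fix x t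
    have time: "deriv (\<lambda>\<tau>. U (x - s * \<tau>)) t = - s * F (U (x - s * t))"
    proof (rule DERIV_imp_deriv)
      have "((\<lambda>\<tau>. x - s * \<tau>) has_real_derivative - s) (at t)"
        by (auto intro!: derivative_eq_intros)
      from DERIV_chain2[OF U this]
      show "((\<lambda>\<tau>. U (x - s * \<tau>)) has_real_derivative - s * F (U (x - s * t))) (at t)"
        by (simp add: mult.commute)
    qed
    have ln1: "deriv (\<lambda>\<xi>. ln (U (\<xi> - s * t))) = (\<lambda>\<xi>. G (U (\<xi> - s * t)))"
    proof (rule ext, rule DERIV_imp_deriv)
      fix x show "((\<lambda>\<xi>. ln (U (\<xi> - s * t))) has_real_derivative G (U (x - s * t))) (at x)"
        by (rule derivative_eq_intros shift pos refl)+ (use pos[of "x - s * t"] in \<open>simp add: F_def\<close>)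
    qed
    have ln2: "deriv (\<lambda>\<xi>. G (U (\<xi> - s * t))) x = (deriv f (U (x - s * t)) - s) * F (U (x - s * t))"
      by (rule DERIV_imp_deriv[OF DERIV_chain2[OF G shift]])
    have flux: "deriv (\<lambda>\<xi>. f (U (\<xi> - s * t))) x = deriv f (U (x - s * t)) * F (U (x - s * t))"
      by (rule DERIV_imp_deriv[OF DERIV_chain2[OF Df shift]])
    show "deriv (\<lambda>\<tau>. U (x - s * \<tau>)) t - (deriv ^^ 2) (\<lambda>\<xi>. ln (U (\<xi> - s * t))) x
        + deriv (\<lambda>\<xi>. f (U (\<xi> - s * t))) x = 0"
      by (simp add: numeral_2_eq_2 time ln1 ln2 flux) (simp add: algebra_simps)
  qed
  moreover have "- s * deriv U z - deriv (\<lambda>y. deriv U y / U y) z + deriv (\<lambda>y. f (U y)) z = 0" for z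
  proof -
    have "(\<lambda>y. deriv U y / U y) = (\<lambda>y. G (U y))"
      using pos by (auto simp: dU F_def less_imp_neq[symmetric])
    then show ?thesis
      by (simp add: dU DERIV_imp_deriv[OF DERIV_chain2[OF G U]] DERIV_imp_deriv[OF DERIV_chain2[OF Df U]]
          algebra_simps)
  qed
  ultimately show ?thesis
    unfolding shock_profile_def using top bot by blast
qed

section \<open>Existence and uniqueness up to a shift\<close>

lemma shock_profile_exists:
  assumes f: "C_k 1 f" and um: "0 < um" and rh: "gfun f s um 0 = 0"
    and neg: "\<And>u. 0 < u \<Longrightarrow> u < um \<Longrightarrow> gfun f s um u < 0"
  shows "\<exists>U. shock_profile f s um U \<and> vanishing_flux U"
proof -
  define F where "F = (\<lambda>u. u * gfun f s um u)"
  define F' where "F' = (\<lambda>u. gfun f s um u + u * (deriv f u - s))"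
  have fd: "f differentiable (at u)" for u
    using f by (simp add: C_k_Suc)
  have F: "(F has_real_derivative F' u) (at u)" for u
    unfolding F_def F'_def by (rule gfun_ode_rhs_derivative[OF fd])
  have contG: "isCont (gfun f s um) u" for u
    by (rule DERIV_isCont[OF gfun_has_derivative[OF fd]])
  have "continuous_on {0..um} (deriv f)"
    using f continuous_on_subset by (fastforce simp: C_k_def)
  then have "continuous_on {0..um} F'"
    unfolding F'_def
    by (intro continuous_intros) (auto intro: continuous_at_imp_continuous_on contG)
  then have "bounded (F' ` {0..um})"
    by (intro compact_imp_bounded compact_continuous_image) auto
  then obtain K where K: "\<And>x. x \<in> {0..um} \<Longrightarrow> norm (F' x) \<le> K"
    unfolding bounded_iff by blast
  \<comment> \<open>\<open>F\<close> vanishes at both ends, so a Lipschitz constant on the closed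
    interval gives both linear bounds required for a connecting orbit on the whole line.\<close>
  have lip: "norm (F u - F v) \<le> K * norm (u - v)" if "u \<in> {0..um}" "v \<in> {0..um}" for u v
    by (rule field_differentiable_bound[of "{0..um}" F F'])
      (use that K in \<open>auto intro: has_field_derivative_at_within F\<close>)
  have ends: "F 0 = 0" "F um = 0"
    by (simp_all add: F_def gfun_def)
  have F_neg: "F u < 0" if "0 < u" "u < um" for u
    using neg[OF that] that by (simp add: F_def mult_less_0_iff)
  have K_bounds: "- F u \<le> K * (u - 0)" "- F u \<le> K * (um - u)" if "0 < u" "u < um" for u
    using lip[of u 0] lip[of u um] that ends by auto
  obtain U where U: "\<And>z. 0 < U z" "\<And>z. U z < um"
    "\<And>z. (U has_real_derivative F (U z)) (at z)" "(U \<longlongrightarrow> 0) at_top" "(U \<longlongrightarrow> um) at_bot"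
    by (rule autonomous_ode_connecting_orbit[of 0 um F K, OF um DERIV_isCont[OF F] F_neg K_bounds]) blast+
  \<comment> \<open>The flux tends to \<open>gfun f s um 0\<close>, which is 0 by
    \<open>rh\<close>.\<close>
  have "deriv U z / U z = gfun f s um (U z)" for z
    using DERIV_imp_deriv[OF U(3), of z] U(1)[of z] by (simp add: F_def)
  moreover have "((\<lambda>z. gfun f s um (U z)) \<longlongrightarrow> gfun f s um 0) at_top"
    by (rule isCont_tendsto_compose[OF contG U(4)])
  ultimately have "vanishing_flux U"
    by (simp add: vanishing_flux_def rh)
  moreover have "shock_profile f s um U"
    using U by (intro ode_solution_is_shock_profile f um) (auto simp: F_def)
  ultimately show ?thesis by blast
qed

lemma shock_profile_unique:
  assumes f: "\<And>u. f differentiable (at u)" and um: "0 < um"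
    and U: "shock_profile f s um U" and V: "shock_profile f s um V"
  shows "\<exists>a. \<forall>z. V z = U (z + a)"
proof (rule autonomous_ode_unique_up_to_shift[OF um, where F = "\<lambda>u. u * gfun f s um u"])
  fix u assume u: "0 < u" "u < um"
  show "isCont (\<lambda>u. u * gfun f s um u) u"
    by (rule DERIV_isCont[OF gfun_ode_rhs_derivative[OF f]])
  show "u * gfun f s um u < 0"
    using shock_profile_monotone(2)[OF U f um u] u by (simp add: mult_less_0_iff)
qed (use shock_profile_ode[OF U f um] shock_profile_monotone(1)[OF U f um]
      shock_profile_ode[OF V f um] shock_profile_monotone(1)[OF V f um] in auto)

section \<open>Convergence rates at the two end states\<close>

lemma exact_order_gfun_leading_term:
  assumes "C_k (Suc k) f" "exact_order (gfun f s v) v k"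
  obtains l where "l \<noteq> 0" "((\<lambda>u. gfun f s v u / (u - v) ^ Suc k) \<longlongrightarrow> l) (at v)"
proof
  \<comment> \<open>\<open>exact_order\<close> starts at the first derivative; for
    \<open>i = 0\<close> the value vanishes by the choice of base point.\<close>
  have "(deriv ^^ i) (gfun f s v) v = 0" if "i \<le> k" for i
    using assms(2) that by (cases "i = 0") (auto simp: exact_order_def gfun_def)
  with C_k_gfun[OF assms(1)]
  show "((\<lambda>u. gfun f s v u / (u - v) ^ Suc k) \<longlongrightarrow>
      (deriv ^^ Suc k) (gfun f s v) v / fact (Suc k)) (at v)"
    by (rule taylor_leading_term)
  show "(deriv ^^ Suc k) (gfun f s v) v / fact (Suc k) \<noteq> 0"
    using assms(2) by (simp add: exact_order_def)
qed

text \<open>With \<open>g(U) = - R * U ^ (k + 1)\<close>, the extra factor \<open>U\<close> of the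
  equation gives \<open>U' = - R * U ^ (k + 2)\<close>. This is \<open>algebraic_decay\<close> with
  \<open>m = k + 1\<close>.\<close>

lemma shock_profile_decay_at_top:
  assumes f: "C_k (Suc k) f" and um: "0 < um" and sp: "shock_profile f s um U"
    and rh: "gfun f s um = gfun f s 0" and ord: "exact_order (gfun f s 0) 0 k"
  shows "comparable at_top (\<lambda>z. \<bar>U z - 0\<bar>) (\<lambda>z. \<bar>z\<bar> powr (- (1 / (1 + real k))))"
proof -
  have fd: "f differentiable (at u)" for u
    using f C_k_Suc by blast
  note ode = shock_profile_ode[OF sp fd um] and mono = shock_profile_monotone[OF sp fd um]
  have top: "(U \<longlongrightarrow> 0) at_top"
    using sp by (simp add: shock_profile_def)
  obtain l where l: "l \<noteq> 0" "((\<lambda>u. gfun f s 0 u / (u - 0) ^ Suc k) \<longlongrightarrow> l) (at 0)"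
    using exact_order_gfun_leading_term[OF f ord] .
  define R where "R = (\<lambda>z. - (gfun f s um (U z) / U z ^ Suc k))"
  have "filterlim U (at 0) at_top"
    using top ode(1) by (intro filterlim_atI) (auto simp: less_imp_neq[symmetric])
  from filterlim_compose[OF l(2) this] have R: "(R \<longlongrightarrow> - l) at_top"
    unfolding R_def rh by (intro tendsto_intros) simp
  \<comment> \<open>The sign of the leading coefficient is inherited from \<open>g < 0\<close> along
    the profile, and \<open>l \<noteq> 0\<close> makes it strict.\<close>
  have "R z \<ge> 0" for z
    using mono(2)[OF ode(1) mono(1)] ode(1)[of z] by (simp add: R_def divide_nonpos_nonneg less_imp_le)
  then have "- l \<ge> 0"
    by (intro tendsto_lowerbound[OF R]) auto
  with l have "- l > 0" by simp
  have "comparable at_top U (\<lambda>z. \<bar>z\<bar> powr (- (1 / real (Suc k))))"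
  proof (rule algebraic_decay[OF ode(1) _ _ R \<open>- l > 0\<close>])
    fix z
    have "- (R z * U z ^ Suc (Suc k)) = U z * gfun f s um (U z)"
      using ode(1)[of z] by (simp add: R_def)
    then show "(U has_real_derivative - (R z * U z ^ Suc (Suc k))) (at z)"
      using ode(2)[of z] by (simp only:)
  qed simp
  moreover have "\<bar>U z - 0\<bar> = U z" for z
    using ode(1)[of z] by simp
  ultimately show ?thesis
    by simp
qed

text \<open>Reflecting \<open>z\<close> and measuring the distance from \<open>um\<close> turns the
  approach to \<open>um\<close> at -infinity into the decay of a positive function at +infinity, the
  setting of both decay lemmas.\<close>

lemma shock_profile_reflected:
  assumes f: "\<And>u. f differentiable (at u)" and um: "0 < um" and sp: "shock_profile f s um U"
    and W_def: "W = (\<lambda>z. um - U (- z))"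
  shows "0 < W z" "W z < um"
    "(W has_real_derivative (um - W z) * gfun f s um (um - W z)) (at z)"
    "(W \<longlongrightarrow> 0) at_top" "filterlim (\<lambda>z. um - W z) (at um) at_top"
    "comparable at_bot (\<lambda>z. \<bar>U z - um\<bar>) B \<longleftrightarrow> comparable at_top W (\<lambda>z. B (- z))"
proof -
  note ode = shock_profile_ode[OF sp f um] and mono = shock_profile_monotone[OF sp f um]
  show W: "0 < W z" "W z < um" for z
    using ode(1) mono(1) by (auto simp: W_def)
  show "(W has_real_derivative (um - W z) * gfun f s um (um - W z)) (at z)"
    using DERIV_diff[OF DERIV_const DERIV_chain2[OF ode(2) DERIV_minus[OF DERIV_ident]], of um z]
    by (simp add: W_def)
  have "((\<lambda>z. U (- z)) \<longlongrightarrow> um) at_top"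
    using sp filterlim_compose[OF _ filterlim_uminus_at_bot_at_top]
    by (auto simp: shock_profile_def)
  then have lim: "((\<lambda>z. um - W z) \<longlongrightarrow> um) at_top"
    by (simp add: W_def)
  from tendsto_diff[OF tendsto_const[of um] this] show "(W \<longlongrightarrow> 0) at_top"
    by simp
  show "filterlim (\<lambda>z. um - W z) (at um) at_top"
    using lim W(1) by (intro filterlim_atI) (auto simp: less_imp_neq[symmetric])
  have "\<bar>U (- z) - um\<bar> = W z" for z
    using W(1)[of z] by (simp add: W_def)
  then show "comparable at_bot (\<lambda>z. \<bar>U z - um\<bar>) B \<longleftrightarrow> comparable at_top W (\<lambda>z. B (- z))"
    by (simp add: comparable_at_bot)
qed

text \<open>Near \<open>um\<close> the factor \<open>U\<close> tends to \<open>um\<close> and joins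
  the coefficient \<open>R\<close>. The right-hand side has order \<open>k + 1\<close> in
  \<open>W\<close>, so \<open>algebraic_decay\<close> applies with \<open>m = k\<close>.\<close>

lemma shock_profile_decay_at_bot_degenerate:
  assumes f: "C_k (Suc k) f" and um: "0 < um" and sp: "shock_profile f s um U"
    and ord: "exact_order (gfun f s um) um k" and "0 < k"
  shows "comparable at_bot (\<lambda>z. \<bar>U z - um\<bar>) (\<lambda>z. \<bar>z\<bar> powr (- (1 / real k)))"
proof -
  have fd: "f differentiable (at u)" for u
    using f C_k_Suc by blast
  define W where "W = (\<lambda>z. um - U (- z))"
  note W = shock_profile_reflected[OF fd um sp W_def]
  obtain l where l: "l \<noteq> 0" "((\<lambda>u. gfun f s um u / (u - um) ^ Suc k) \<longlongrightarrow> l) (at um)"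
    using exact_order_gfun_leading_term[OF f ord] .
  \<comment> \<open>The state is approached from below, \<open>u - um = - W\<close>. The last factor
    turns division by \<open>(- W) ^ Suc k\<close> into division by \<open>W ^ Suc k\<close>, while
    the quotient keeps the form of the Taylor limit.\<close>
  define R where "R = (\<lambda>z. - ((um - W z) * (gfun f s um (um - W z) / (um - W z - um) ^ Suc k)) * (- 1) ^ Suc k)"
  define c where "c = - (um * l) * (- 1) ^ Suc k"
  have "((\<lambda>z. um - W z) \<longlongrightarrow> um) at_top"
    using tendsto_diff[OF tendsto_const[of um] W(4)] by simp
  from tendsto_mult[OF tendsto_minus[OF tendsto_mult[OF this filterlim_compose[OF l(2) W(5)]]] tendsto_const]
  have R: "(R \<longlongrightarrow> c) at_top"
    unfolding R_def c_def .
  have R_eq: "R z = - ((um - W z) * gfun f s um (um - W z)) / W z ^ Suc k" for z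
  proof -
    define e :: real where "e = (- 1) ^ Suc k"
    have "e \<noteq> 0" by (simp add: e_def)
    have "(um - W z - um) ^ Suc k = e * W z ^ Suc k"
      unfolding e_def by (simp flip: power_mult_distrib del: power_Suc)
    then show ?thesis
      using \<open>e \<noteq> 0\<close> unfolding R_def e_def[symmetric] by (simp del: power_Suc)
  qed
  have "R z \<ge> 0" for z
  proof -
    have "gfun f s um (um - W z) < 0"
      using W(1,2)[of z] by (intro shock_profile_monotone(2)[OF sp fd um]) auto
    then have "(um - W z) * gfun f s um (um - W z) \<le> 0"
      using W(2)[of z] by (simp add: mult_le_0_iff)
    then show ?thesis
      using W(1)[of z] by (simp add: R_eq divide_le_0_iff del: power_Suc)
  qed
  then have "c \<ge> 0"
    by (intro tendsto_lowerbound[OF R]) auto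
  moreover have "c \<noteq> 0"
    using um l by (simp add: c_def)
  ultimately have "c > 0" by simp
  have "comparable at_top W (\<lambda>z. \<bar>z\<bar> powr (- (1 / real k)))"
  proof (rule algebraic_decay[OF W(1) _ \<open>0 < k\<close> R \<open>c > 0\<close>])
    fix z
    have "- (R z * W z ^ Suc k) = (um - W z) * gfun f s um (um - W z)"
      using W(1)[of z] by (simp add: R_eq)
    then show "(W has_real_derivative - (R z * W z ^ Suc k)) (at z)"
      using W(3)[of z] by (simp only:)
  qed
  then show ?thesis
    by (simp add: W(6))
qed

text \<open>Second-order Taylor expansion of \<open>g\<close> at \<open>um\<close> shows that the
  coefficient \<open>R\<close> differs from \<open>um * \<mu>\<close> by at most a multiple of
  \<open>W\<close>, as \<open>exponential_decay\<close> requires.\<close>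

lemma shock_profile_decay_at_bot:
  assumes f: "C_k 2 f" and um: "0 < um" and sp: "shock_profile f s um U" and "s < deriv f um"
  shows "comparable at_bot (\<lambda>z. \<bar>U z - um\<bar>) (\<lambda>z. exp (- (um * (deriv f um - s)) * \<bar>z\<bar>))"
proof -
  have fd: "f differentiable (at u)" for u
    using f by (simp add: numeral_2_eq_2 C_k_Suc)
  define W where "W = (\<lambda>z. um - U (- z))"
  note W = shock_profile_reflected[OF fd um sp W_def]
  define \<mu> where "\<mu> = deriv f um - s"
  \<comment> \<open>With the slope of \<open>f\<close> at \<open>um\<close> as the speed,
    \<open>gfun\<close> is the remainder of the tangent line, which vanishes to second order at
    \<open>um\<close>.\<close>
  define h where "h = gfun f (deriv f um) um"
  have h: "gfun f s um u = h u + \<mu> * (u - um)" for u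
    by (simp add: gfun_def h_def \<mu>_def algebra_simps)
  have "h um = 0" "deriv h um = 0"
    using DERIV_imp_deriv[OF gfun_has_derivative[OF fd]] by (simp_all add: h_def gfun_def)
  then have "(deriv ^^ i) h um = 0" if "i \<le> 1" for i
    using that by (cases "i = 0") (auto simp: le_Suc_eq)
  then obtain l where "((\<lambda>u. h u / (u - um) ^ Suc 1) \<longlongrightarrow> l) (at um)"
    using taylor_leading_term[of 1 h um] f C_k_gfun[of 1 f] by (auto simp: h_def numeral_2_eq_2)
  from filterlim_compose[OF this W(5)]
  have "((\<lambda>z. \<bar>h (um - W z) / (um - W z - um) ^ Suc 1\<bar>) \<longlongrightarrow> \<bar>l\<bar>) at_top"
    by (rule tendsto_rabs)
  then have ev: "eventually (\<lambda>z. \<bar>h (um - W z) / (um - W z - um) ^ Suc 1\<bar> < \<bar>l\<bar> + 1) at_top"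
    by (rule order_tendstoD) simp
  define R where "R = (\<lambda>z. - ((um - W z) * gfun f s um (um - W z)) / W z)"
  have "comparable at_top W (\<lambda>z. exp (- (um * \<mu>) * \<bar>z\<bar>))"
  proof (rule exponential_decay[OF W(1) _ W(4)])
    fix z
    have "- (R z * W z) = (um - W z) * gfun f s um (um - W z)"
      using W(1)[of z] by (simp add: R_def)
    then show "(W has_real_derivative - (R z * W z)) (at z)"
      using W(3)[of z] by (simp only:)
  next
    \<comment> \<open>With \<open>h = q * W\<^sup>2\<close>, the difference
      \<open>R - um * \<mu>\<close> equals \<open>(- \<mu> - (um - W) * q) * W\<close>; the constant
      comes from \<open>um - W \<le> um\<close> and the eventual bound
      \<open>\<bar>l\<bar> + 1\<close> on \<open>\<bar>q\<bar>\<close>.\<close>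
    show "eventually (\<lambda>z. \<bar>R z - um * \<mu>\<bar> \<le> (\<bar>\<mu>\<bar> + um * (\<bar>l\<bar> + 1)) * W z) at_top"
      using ev
    proof eventually_elim
      case (elim z)
      define q where "q = h (um - W z) / (um - W z - um) ^ Suc 1"
      have "h (um - W z) = q * W z * W z"
        using W(1)[of z] by (simp add: q_def)
      then have "R z - um * \<mu> = (- \<mu> - (um - W z) * q) * W z"
        using W(1)[of z] by (simp add: R_def h field_simps)
      then have "\<bar>R z - um * \<mu>\<bar> = \<bar>- \<mu> - (um - W z) * q\<bar> * W z"
        using W(1)[of z] by (simp add: abs_mult)
      also have "\<bar>- \<mu> - (um - W z) * q\<bar> \<le> \<bar>\<mu>\<bar> + \<bar>um - W z\<bar> * \<bar>q\<bar>"
        unfolding abs_mult[symmetric] by linarith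
      also have "\<bar>um - W z\<bar> * \<bar>q\<bar> \<le> um * (\<bar>l\<bar> + 1)"
        using W(1,2)[of z] elim by (intro mult_mono) (auto simp: q_def)
      finally show ?case
        using W(1)[of z] by (simp add: mult_right_mono)
    qed
    show "0 < um * \<mu>"
      using um assms(4) by (simp add: \<mu>_def)
  qed
  then show ?thesis
    by (simp add: W(6) \<mu>_def)
qed

text \<open>Under the Rankine-Hugoniot condition the two base points give the same \<open>g\<close>,
  so the flux of every profile tends to \<open>g(0) = 0\<close>. This is why uniqueness and the
  rates are claimed for all profiles, while the necessity of that condition is claimed for those
  with vanishing flux.\<close>

theorem theorem2p1:
  fixes f :: "real \<Rightarrow> real" and s um :: real and kp km :: nat
  assumes "0 < um"
    and "C_k (max (max (kp + 1) (km + 1)) 3) f"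
    and "exact_order (gfun f s 0) 0 kp"
    and "exact_order (gfun f s um) um km"
  shows
    "(\<forall>U. shock_profile f s um U \<longrightarrow>
        (\<forall>u. 0 < u \<and> u < um \<longrightarrow> gfun f s um u < 0) \<and>
        (vanishing_flux U \<longrightarrow>
           rankine_hugoniot f s um \<and> (\<forall>u. 0 < u \<and> u < um \<longrightarrow> gfun f s 0 u < 0)))
     \<and>
     (rankine_hugoniot f s um \<and> (\<forall>u. 0 < u \<and> u < um \<longrightarrow> gfun f s 0 u < 0) \<longrightarrow>
        (\<exists>U. shock_profile f s um U \<and> vanishing_flux U) \<and>
        (\<forall>U V. shock_profile f s um U \<and> shock_profile f s um V \<longrightarrow> (\<exists>a. \<forall>z. V z = U (z + a))) \<and>
        (\<forall>U. shock_profile f s um U \<longrightarrow>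
           (\<forall>z. deriv U z < 0) \<and>
           (deriv f 0 < s \<and> s < deriv f um \<longrightarrow>
              comparable at_top (\<lambda>z. \<bar>U z - 0\<bar>) (\<lambda>z. \<bar>z\<bar> powr (- 1)) \<and>
              comparable at_bot (\<lambda>z. \<bar>U z - um\<bar>)
                (\<lambda>z. exp (- (um * (deriv f um - s)) * \<bar>z\<bar>))) \<and>
           (deriv f 0 = s \<longrightarrow>
              comparable at_top (\<lambda>z. \<bar>U z - 0\<bar>) (\<lambda>z. \<bar>z\<bar> powr (- (1 / (1 + real kp))))) \<and>
           (deriv f um = s \<longrightarrow>
              comparable at_bot (\<lambda>z. \<bar>U z - um\<bar>) (\<lambda>z. \<bar>z\<bar> powr (- (1 / real km))))))"
proof -
  have C: "C_k (Suc kp) f" "C_k (Suc km) f" "C_k 2 f" "C_k 1 f"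
    using C_k_mono[OF assms(2)] by auto
  have fd: "f differentiable (at u)" for u
    using C(1) C_k_Suc by blast
  note um = assms(1)
  have g_eq: "gfun f s um = gfun f s 0" if "rankine_hugoniot f s um"
  proof -
    have "s * um = f um - f 0"
      using that um by (simp add: rankine_hugoniot_def field_simps)
    then show ?thesis
      by (auto simp: gfun_def algebra_simps)
  qed
  have rh: "rankine_hugoniot f s um" if sp: "shock_profile f s um U" and "vanishing_flux U" for U
  proof -
    have "deriv U z / U z = gfun f s um (U z)" for z
      using shock_profile_ode[OF sp fd um, of z] by (simp add: DERIV_imp_deriv)
    moreover have "((\<lambda>z. gfun f s um (U z)) \<longlongrightarrow> gfun f s um 0) at_top"
      using sp by (intro isCont_tendsto_compose[OF DERIV_isCont[OF gfun_has_derivative[OF fd]]])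
        (simp add: shock_profile_def)
    ultimately have "gfun f s um 0 = 0"
      using \<open>vanishing_flux U\<close> tendsto_unique[OF trivial_limit_at_top_linorder]
      by (simp add: vanishing_flux_def)
    then show ?thesis
      using um by (simp add: rankine_hugoniot_def gfun_def field_simps)
  qed
  have gderiv: "deriv (gfun f s v) u = deriv f u - s" for v u
    by (rule DERIV_imp_deriv[OF gfun_has_derivative[OF fd]])
  \<comment> \<open>\<open>g'(0)\<close> is nonzero here, so the rate \<open>1 / z\<close> is the
    case \<open>kp = 0\<close> of the general exponent at 0.\<close>
  have kp: "kp = 0" if "deriv f 0 < s"
  proof (rule ccontr)
    assume "kp \<noteq> 0"
    then have "1 \<in> {1..kp}" by simp
    then have "(deriv ^^ 1) (gfun f s 0) 0 = 0"
      using assms(3) unfolding exact_order_def by blast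
    with that show False by (simp add: gderiv)
  qed
  \<comment> \<open>Positivity is what keeps the exponent \<open>1 / km\<close> meaningful and
    allows the algebraic rate at \<open>um\<close>.\<close>
  have km: "km > 0" if "deriv f um = s"
  proof (rule ccontr)
    assume "\<not> km > 0"
    then have "deriv (gfun f s um) um \<noteq> 0"
      using assms(4) by (simp add: exact_order_def)
    with that show False by (simp add: gderiv)
  qed
  have dU: "deriv U z < 0" if "shock_profile f s um U" for U z
    using DERIV_imp_deriv[OF shock_profile_ode(2)[OF that fd um]] shock_profile_ode(1)[OF that fd um]
      shock_profile_monotone[OF that fd um] by (simp add: mult_less_0_iff)
  show ?thesis
  proof (intro conjI allI impI; (elim conjE)?)
    fix U u assume "shock_profile f s um U" "0 < u" "u < um"
    then show "gfun f s um u < 0"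
      by (intro shock_profile_monotone(2)[OF _ fd um])
  next
    fix U assume "shock_profile f s um U" "vanishing_flux U"
    then show "rankine_hugoniot f s um"
      by (rule rh)
  next
    fix U u assume "shock_profile f s um U" "vanishing_flux U" "0 < u" "u < um"
    then show "gfun f s 0 u < 0"
      using rh g_eq shock_profile_monotone(2)[OF _ fd um] by metis
  next
    assume "rankine_hugoniot f s um" "\<forall>u. 0 < u \<and> u < um \<longrightarrow> gfun f s 0 u < 0"
    then show "\<exists>U. shock_profile f s um U \<and> vanishing_flux U"
      by (intro shock_profile_exists C um) (auto simp: g_eq gfun_def[of f s 0 0])
  next
    fix U V assume "shock_profile f s um U" "shock_profile f s um V"
    then show "\<exists>a. \<forall>z. V z = U (z + a)"
      by (rule shock_profile_unique[OF fd um])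
  next
    fix U z assume "shock_profile f s um U"
    then show "deriv U z < 0"
      by (rule dU)
  next
    fix U assume "rankine_hugoniot f s um" "shock_profile f s um U" "deriv f 0 < s"
    then show "comparable at_top (\<lambda>z. \<bar>U z - 0\<bar>) (\<lambda>z. \<bar>z\<bar> powr (- 1))"
      using shock_profile_decay_at_top[OF C(1) um _ g_eq assms(3)] kp by simp
  next
    fix U assume "shock_profile f s um U" "s < deriv f um"
    then show "comparable at_bot (\<lambda>z. \<bar>U z - um\<bar>)
        (\<lambda>z. exp (- (um * (deriv f um - s)) * \<bar>z\<bar>))"
      by (rule shock_profile_decay_at_bot[OF C(3) um])
  next
    fix U assume "rankine_hugoniot f s um" "shock_profile f s um U"
    then show "comparable at_top (\<lambda>z. \<bar>U z - 0\<bar>) (\<lambda>z. \<bar>z\<bar> powr (- (1 / (1 + real kp))))"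
      by (intro shock_profile_decay_at_top[OF C(1) um _ g_eq assms(3)])
  next
    fix U assume "shock_profile f s um U" "deriv f um = s"
    then show "comparable at_bot (\<lambda>z. \<bar>U z - um\<bar>) (\<lambda>z. \<bar>z\<bar> powr (- (1 / real km)))"
      by (intro shock_profile_decay_at_bot_degenerate[OF C(2) um _ assms(4)] km)
  qed
qed

end
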